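(* Let $\mathbb{F}$ be a field, let $n$ be a positive integer, let $A\in M_n$, and let $N$ be an integer with $N\ge n+1$. For any $N$-tuple $S=(A_1,A_2,\dots,A_N)$ with $A_i\in M_n$, $i=1,\dots,N$, the following relation holds: $$\sum_{k=0}^N (-1)^k \sum_{\substack{\Omega\in \Sigma(S)\\ |\Omega|=k}}\det\left(A+\sum_{A_i\in\Omega}A_i\right)=0.$$
   Context: $M_n$ denotes the set of $n\times n$ matrices over an arbitrary field $\mathbb{F}$. For an $N$-tuple $S=(A_1,\dots,A_N)$ of matrices in $M_n$, $\Sigma(S)$ is the set of all formal sums of matrices of $S$ in which each $A_i$, $i=1,\dots,N$, appears at most once (equivalently, formal sums $\sum_{i\in I}A_i$ indexed by subsets $I\subseteq\{1,\dots,N\}$; the empty sum, i.e. the null matrix, is included). $|\Omega|=k$ means that $\Omega$ is a formal sum with $k$ summands, and $A_i\in\Omega$ means that $A_i$ is a summand in $\Omega$. *)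

theory Defs
  imports "HOL-Analysis.Determinants"
begin

end

theory Submission
  imports Defs
begin

text \<open>
  As a function of the subset \<open>I\<close>, every term in the Leibniz expansion of
  \<open>det (A + (\<Sum>i\<in>I. S i))\<close> is a product of \<open>CARD('n)\<close> factors, each affine in the indicator of
  \<open>I\<close>. It is therefore a polynomial of degree at most \<open>CARD('n)\<close> in the indicator variables, while
  the alternating sum over all subsets of an \<open>N\<close>-element set is an \<open>N\<close>-fold finite difference and
  kills every polynomial of degree less than \<open>N\<close>. The vanishing is lemma
  \<open>alternating_sum_prod_affine\<close>; linearity of the alternating sum carries it over to the
  determinant.
\<close>

lemma sum_subsets_containing:
  assumes "i \<in> T"
  shows "(\<Sum>I | I \<subseteq> T \<and> i \<in> I. g I) = (\<Sum>J\<in>Pow (T - {i}). g (insert i J))"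
proof (rule sum.reindex_bij_witness[where i = "insert i" and j = "\<lambda>I. I - {i}"])
qed (use assms in \<open>auto simp: insert_absorb\<close>)

lemma alternating_sum_Pow_insert:
  fixes g :: "'b set \<Rightarrow> 'a::comm_ring_1"
  assumes "finite T"
  shows "(\<Sum>J\<in>Pow (T - {i}). (-1) ^ card (insert i J) * g J)
    = - (\<Sum>J\<in>Pow (T - {i}). (-1) ^ card J * g J)"
proof -
  have "card (insert i J) = Suc (card J)" if "J \<in> Pow (T - {i})" for J
    using that assms by (subst card_insert_disjoint) (auto intro: finite_subset)
  then show ?thesis
    by (simp add: sum_negf)
qed

text \<open>The subsets pair off as \<open>J\<close> and \<open>insert t J\<close> for a fixed \<open>t\<close>, with opposite signs.\<close>

lemma alternating_sum_Pow_eq_0: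
  assumes "finite T" "T \<noteq> {}"
  shows "(\<Sum>I\<in>Pow T. (-1) ^ card I) = (0 :: 'a::comm_ring_1)"
proof -
  obtain t where t: "t \<in> T"
    using assms by auto
  have "Pow T = {I. I \<subseteq> T \<and> t \<in> I} \<union> Pow (T - {t})"
    by auto
  moreover have "finite {I. I \<subseteq> T \<and> t \<in> I}"
    using assms(1) by simp
  ultimately have "(\<Sum>I\<in>Pow T. (-1) ^ card I) =
      (\<Sum>I | I \<subseteq> T \<and> t \<in> I. (-1) ^ card I) + (\<Sum>I\<in>Pow (T - {t}). (-1 :: 'a) ^ card I)"
    using assms(1) by (simp only:) (rule sum.union_disjoint, auto)
  also have "\<dots> = 0"
    using alternating_sum_Pow_insert[OF assms(1), of t "\<lambda>_. 1 :: 'a"]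
    by (simp add: sum_subsets_containing[OF t])
  finally show ?thesis .
qed

text \<open>
  Peeling off one factor \<open>a u + (\<Sum>i\<in>I. f i u)\<close> lowers the degree by one. Its constant part leaves
  an alternating sum with fewer factors. For its part \<open>f i u\<close>, only the subsets containing \<open>i\<close>
  contribute, and these are the sets \<open>insert i J\<close> with \<open>J \<subseteq> T - {i}\<close>: the element \<open>i\<close> is absorbed
  into the constants, and both the number of factors and the size of the index set drop by one.
  This is why the induction must leave \<open>T\<close> and \<open>a\<close> arbitrary.
\<close>

lemma alternating_sum_prod_affine:
  fixes a :: "'u \<Rightarrow> 'a::comm_ring_1" and f :: "'b \<Rightarrow> 'u \<Rightarrow> 'a"
  assumes "finite U" "finite T" "card U < card T"
  shows "(\<Sum>I\<in>Pow T. (-1) ^ card I * (\<Prod>u\<in>U. a u + (\<Sum>i\<in>I. f i u))) = 0"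
  using assms
proof (induction U arbitrary: T a rule: finite_induct)
  case empty
  then have "T \<noteq> {}"
    by auto
  with empty show ?case
    by (simp add: alternating_sum_Pow_eq_0)
next
  case (insert u U)
  define P where "P a I = (\<Prod>v\<in>U. a v + (\<Sum>i\<in>I. f i v))" for a :: "'u \<Rightarrow> 'a" and I
  have contribution: "(\<Sum>I | I \<subseteq> T \<and> i \<in> I. (-1) ^ card I * P a I) = 0" if i: "i \<in> T" for i
  proof -
    have absorb: "P a (insert i J) = P (\<lambda>v. a v + f i v) J" if "J \<in> Pow (T - {i})" for J
    proof -
      have "finite J" "i \<notin> J"
        using that insert.prems by (auto intro: finite_subset)
      then show ?thesis
        by (simp add: P_def add.assoc)
    qed
    have "(\<Sum>I | I \<subseteq> T \<and> i \<in> I. (-1) ^ card I * P a I)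
        = (\<Sum>J\<in>Pow (T - {i}). (-1) ^ card (insert i J) * P (\<lambda>v. a v + f i v) J)"
      unfolding sum_subsets_containing[OF i] by (intro sum.cong refl) (simp only: absorb)
    also have "\<dots> = - (\<Sum>J\<in>Pow (T - {i}). (-1) ^ card J * P (\<lambda>v. a v + f i v) J)"
      by (rule alternating_sum_Pow_insert[OF insert.prems(1)])
    also have "\<dots> = 0"
      using insert.IH[of "T - {i}" "\<lambda>v. a v + f i v"] insert.prems insert.hyps i
      by (simp add: P_def)
    finally show ?thesis .
  qed
  have "(\<Sum>I\<in>Pow T. (-1) ^ card I * (\<Prod>v\<in>insert u U. a v + (\<Sum>i\<in>I. f i v)))
      = (\<Sum>I\<in>Pow T. a u * ((-1) ^ card I * P a I) + (\<Sum>i\<in>I. f i u * ((-1) ^ card I * P a I)))"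
    using insert.hyps
    by (simp add: P_def flip: sum_distrib_right) (simp add: algebra_simps)
  also have "\<dots> = a u * (\<Sum>I\<in>Pow T. (-1) ^ card I * P a I)
      + (\<Sum>I\<in>Pow T. \<Sum>i | i \<in> T \<and> i \<in> I. f i u * ((-1) ^ card I * P a I))"
    unfolding sum.distrib sum_distrib_left by (intro arg_cong2[of _ _ _ _ "(+)"] sum.cong) auto
  also have "(\<Sum>I\<in>Pow T. (-1) ^ card I * P a I) = 0"
    using insert by (simp add: P_def)
  also have "(\<Sum>I\<in>Pow T. \<Sum>i | i \<in> T \<and> i \<in> I. f i u * ((-1) ^ card I * P a I))
      = (\<Sum>i\<in>T. \<Sum>I | I \<in> Pow T \<and> i \<in> I. f i u * ((-1) ^ card I * P a I))"
    using insert.prems by (intro sum.swap_restrict) auto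
  also have "\<dots> = 0"
    using contribution by (simp flip: sum_distrib_left)
  finally show ?case
    by simp
qed

lemma alternating_sum_det:
  fixes A :: "'a::comm_ring_1 ^ 'n ^ 'n" and S :: "'b \<Rightarrow> 'a ^ 'n ^ 'n"
  assumes "finite T" "CARD('n) < card T"
  shows "(\<Sum>I\<in>Pow T. (-1) ^ card I * det (A + (\<Sum>i\<in>I. S i))) = 0"
proof -
  let ?t = "\<lambda>p I. \<Prod>r\<in>UNIV. A $ r $ p r + (\<Sum>i\<in>I. S i $ r $ p r)"
  have "(\<Sum>I\<in>Pow T. (-1) ^ card I * det (A + (\<Sum>i\<in>I. S i)))
      = (\<Sum>I\<in>Pow T. \<Sum>p | p permutes UNIV. of_int (sign p) * ((-1) ^ card I * ?t p I))"
    by (simp add: det_def sum_distrib_left mult.left_commute)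
  also have "\<dots> = (\<Sum>p | p permutes UNIV. of_int (sign p) * (\<Sum>I\<in>Pow T. (-1) ^ card I * ?t p I))"
    by (subst sum.swap) (simp add: sum_distrib_left)
  also have "\<dots> = 0"
    using assms by (simp add: alternating_sum_prod_affine)
  finally show ?thesis .
qed

theorem theorem2p2:
  fixes A :: "'a::field ^ 'n ^ 'n"
    and S :: "nat \<Rightarrow> 'a ^ 'n ^ 'n"
    and N :: nat
  assumes "N \<ge> CARD('n) + 1"
  shows "(\<Sum>k=0..N. (-1) ^ k *
            (\<Sum>I | I \<subseteq> {1..N} \<and> card I = k. det (A + (\<Sum>i\<in>I. S i)))) = 0"
proof -
  let ?g = "\<lambda>I. (-1) ^ card I * det (A + (\<Sum>i\<in>I. S i))"
  have "(\<Sum>k=0..N. (-1) ^ k * (\<Sum>I | I \<subseteq> {1..N} \<and> card I = k. det (A + (\<Sum>i\<in>I. S i))))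
      = (\<Sum>k=0..N. \<Sum>I | I \<in> Pow {1..N} \<and> card I = k. ?g I)"
    by (simp add: sum_distrib_left)
  also have "\<dots> = (\<Sum>I\<in>Pow {1..N}. ?g I)"
  proof (rule sum.group)
    show "card ` Pow {1..N} \<subseteq> {0..N}"
      using card_mono[of "{1..N}"] by fastforce
  qed simp_all
  also have "\<dots> = 0"
    using assms by (intro alternating_sum_det) simp_all
  finally show ?thesis .
qed

end
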